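(* Let $T$ be an $N \times N$ torus network with $N \geq 3$, with a correct source node broadcasting an information $m$ and some set of Byzantine nodes, all correct nodes running the trigger protocol with parameter $H = 2$. Let $D$ be the smallest hop distance between two distinct Byzantine nodes. If $D \geq 5$, then in every execution all correct nodes eventually deliver the authentic message $m$.
   Context: **Torus network.** An $N\times N$ torus network has nodes with unique identifiers $(i,j)$, $1\leq i\leq N$, $1\leq j\leq N$; two nodes $(i_1,j_1)$ and $(i_2,j_2)$ are neighbors if and only if either $i_1=i_2$ and $|j_1-j_2|\in\{1,N-1\}$, or $j_1=j_2$ and $|i_1-i_2|\in\{1,N-1\}$. (For $N\ge 3$ every node has exactly four neighbors.) **Nodes.** A node can send messages only to its neighbors. Each node is either correct (it follows the protocol below) or Byzantine (it behaves arbitrarily, sending arbitrary messages to its neighbors at any time). A distinguished node, the source, is correct; its identity is known. Correct nodes do not know which nodes are Byzantine. To multicast a message is to send it to all one's neighbors. **Execution model.** Message passing is asynchronous: every message sent is eventually received, after an arbitrary finite delay, and in an infinite execution every process is activated infinitely often, in arbitrary order. Channels are authenticated: when a node receives a message from a neighbor $q$, it knows that $q$ sent it (so a Byzantine node cannot lie about its identity to its direct neighbors, but it can put arbitrary content in its messages). An execution is any sequence of events compatible with these rules, the protocol at correct nodes, and arbitrary behavior of Byzantine nodes. **Protocol (with parameter $H$, known to all correct nodes).** There are standard messages $(m)$ and trigger messages $(m,S)$, where $S$ is a set of node identifiers. Each correct node keeps two sets $Wait$ and $Trig$, initially empty. Initially the source multicasts $(m)$ and $(m,\emptyset)$, where $m$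 is the authentic message (the source is regarded as having delivered $m$). Then each correct node follows three rules (in which $m$ stands for an arbitrary message content): - RECEPTION: when a standard message $(m)$ is received from a neighbor $q$: if $q$ is the source, deliver $m$, then multicast $(m)$ and $(m,\emptyset)$; otherwise add $(m,q)$ to $Wait$. - TRANSMISSION: when a trigger message $(m,S)$ is received from a neighbor $q$: if $q \notin S$ and $|S| \leq H-1$, add $(m,S\cup\{q\})$ to $Trig$ and multicast $(m,S\cup\{q\})$. - DECISION: when there exist $m,q,S$ with $(m,q)\in Wait$, $(m,S)\in Trig$ and $q\notin S$: deliver $m$, then multicast $(m)$ and $(m,\emptyset)$. **Distance $D$.** $D$ is the smallest number of hops (graph distance) between two distinct Byzantine nodes; if there are fewer than two Byzantine nodes, $D=\infty$. *)

theory Defs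
  imports Main "HOL-Library.Multiset" "HOL-Library.Extended_Nat"
begin

section \<open>The torus network\<close>

type_synonym node = "nat \<times> nat"

definition nodes :: "nat \<Rightarrow> node set" where
  "nodes N = {1..N} \<times> {1..N}"

definition adj :: "nat \<Rightarrow> (node \<times> node) set" where
  "adj N = {((i1, j1), (i2, j2)). (i1, j1) \<in> nodes N \<and> (i2, j2) \<in> nodes N \<and>
     (i1 = i2 \<and> \<bar>int j1 - int j2\<bar> \<in> {1, int N - 1} \<or>
      j1 = j2 \<and> \<bar>int i1 - int i2\<bar> \<in> {1, int N - 1})}"

text \<open>The infima below are taken in \<^typ>\<open>enat\<close>, where the infimum of the empty set is
  \<open>\<infinity>\<close>; hence \<open>byz_dist N B = \<infinity>\<close> if \<open>B\<close> has fewer than two elements.\<close>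

definition hop_dist :: "nat \<Rightarrow> node \<Rightarrow> node \<Rightarrow> enat" where
  "hop_dist N u v = (INF k \<in> {k. (u, v) \<in> adj N ^^ k}. enat k)"

definition byz_dist :: "nat \<Rightarrow> node set \<Rightarrow> enat" where
  "byz_dist N B = Inf {hop_dist N u v | u v. u \<in> B \<and> v \<in> B \<and> u \<noteq> v}"


section \<open>The protocol\<close>

datatype 'm msg = Std 'm | Trigger 'm "node set"

text \<open>The field \<open>net\<close> is the multiset of messages in flight, each one a triple of sender,
  receiver and message. It is unordered, so channels need not be FIFO. The sender component is
  always the true one, so channels are authenticated.\<close>

record 'm config =
  wait :: "node \<Rightarrow> ('m \<times> node) set"
  trig :: "node \<Rightarrow> ('m \<times> node set) set"
  delivered :: "node \<Rightarrow> 'm set"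
  net :: "(node \<times> node \<times> 'm msg) multiset"

definition multicast :: "nat \<Rightarrow> node \<Rightarrow> 'm msg \<Rightarrow> 'm config \<Rightarrow> 'm config" where
  "multicast N p x c =
     c\<lparr>net := net c + image_mset (\<lambda>q. (p, q, x)) (mset_set {q. (p, q) \<in> adj N})\<rparr>"

definition deliver :: "nat \<Rightarrow> node \<Rightarrow> 'm \<Rightarrow> 'm config \<Rightarrow> 'm config" where
  "deliver N p m c =
     multicast N p (Trigger m {}) (multicast N p (Std m)
       (c\<lparr>delivered := (delivered c)(p := insert m (delivered c p))\<rparr>))"

definition init :: "nat \<Rightarrow> node \<Rightarrow> 'm \<Rightarrow> 'm config" where
  "init N s m = deliver N s m
     \<lparr>wait = (\<lambda>_. {}), trig = (\<lambda>_. {}), delivered = (\<lambda>_. {}), net = {#}\<rparr>"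

text \<open>RECEPTION and TRANSMISSION: the reaction of a correct node \<open>p\<close> to a message received from
  \<open>q\<close>, where \<open>s\<close> is the source. A Byzantine node may send a trigger message with an infinite
  set, whose \<^const>\<open>card\<close> is \<open>0\<close>; hence the explicit finiteness test.\<close>

fun handle :: "nat \<Rightarrow> nat \<Rightarrow> node \<Rightarrow> node \<Rightarrow> node \<Rightarrow> 'm msg \<Rightarrow> 'm config \<Rightarrow> 'm config" where
  "handle N H s q p (Std m) c =
     (if q = s then deliver N p m c
      else c\<lparr>wait := (wait c)(p := insert (m, q) (wait c p))\<rparr>)"
| "handle N H s q p (Trigger m S) c =
     (if q \<notin> S \<and> finite S \<and> int (card S) \<le> int H - 1
      then multicast N p (Trigger m (S \<union> {q}))
             (c\<lparr>trig := (trig c)(p := insert (m, S \<union> {q}) (trig c p))\<rparr>)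
      else c)"

definition decidable :: "'m config \<Rightarrow> node \<Rightarrow> 'm \<Rightarrow> bool" where
  "decidable c p m \<longleftrightarrow> (\<exists>q S. (m, q) \<in> wait c p \<and> (m, S) \<in> trig c p \<and> q \<notin> S)"


section \<open>Executions\<close>

text \<open>\<open>Receive q p x\<close>: node \<open>p\<close> receives \<open>x\<close> from \<open>q\<close>. \<open>Decide p m\<close>: correct node \<open>p\<close> applies
  DECISION to \<open>m\<close>. \<open>Forge b q x\<close>: Byzantine node \<open>b\<close> sends \<open>x\<close> to its neighbor \<open>q\<close>.
  \<open>Idle\<close> pads an execution in which nothing more happens to an infinite one.\<close>

datatype 'm event =
  Receive node node "'m msg" | Decide node 'm | Forge node node "'m msg" | Idle

inductive step :: "nat \<Rightarrow> nat \<Rightarrow> node set \<Rightarrow> node \<Rightarrow> 'm config \<Rightarrow> 'm event \<Rightarrow> 'm config \<Rightarrow> bool"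
  for N H :: nat and B :: "node set" and s :: node where
  receive_correct: "(q, p, x) \<in># net c \<Longrightarrow> p \<in> nodes N - B \<Longrightarrow>
    step N H B s c (Receive q p x) (handle N H s q p x (c\<lparr>net := net c - {#(q, p, x)#}\<rparr>))"
| receive_byz: "(q, p, x) \<in># net c \<Longrightarrow> p \<in> B \<Longrightarrow>
    step N H B s c (Receive q p x) (c\<lparr>net := net c - {#(q, p, x)#}\<rparr>)"
| decide: "p \<in> nodes N - B \<Longrightarrow> decidable c p m \<Longrightarrow>
    step N H B s c (Decide p m) (deliver N p m c)"
| forge: "b \<in> B \<Longrightarrow> (b, q) \<in> adj N \<Longrightarrow>
    step N H B s c (Forge b q x) (c\<lparr>net := add_mset (b, q, x) (net c)\<rparr>)"
| idle: "step N H B s c Idle c"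

text \<open>The last two conjuncts are the fairness conditions. Every message in flight is eventually
  received; as this applies again after each reception while copies remain, it covers every copy.
  Every enabled DECISION is eventually executed, because every correct node is activated
  infinitely often. Since the guard of DECISION, once true, stays true, only one execution per
  node and content is required (possibly an earlier one, with other witnesses \<open>q\<close>, \<open>S\<close>);
  repetitions are allowed.\<close>

definition execution ::
  "nat \<Rightarrow> nat \<Rightarrow> node set \<Rightarrow> node \<Rightarrow> 'm \<Rightarrow> (nat \<Rightarrow> 'm config) \<Rightarrow> (nat \<Rightarrow> 'm event) \<Rightarrow> bool" where
  "execution N H B s m cfg ev \<longleftrightarrow>
     cfg 0 = init N s m \<and>
     (\<forall>t. step N H B s (cfg t) (ev t) (cfg (Suc t))) \<and>
     (\<forall>t q p x. (q, p, x) \<in># net (cfg t) \<longrightarrow> (\<exists>t'\<ge>t. ev t' = Receive q p x)) \<and>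
     (\<forall>t. \<forall>p \<in> nodes N - B. \<forall>m'. decidable (cfg t) p m' \<longrightarrow> (\<exists>t'. ev t' = Decide p m'))"

end

theory Submission
  imports Defs
begin

text \<open>Let \<open>L\<close> be the set of correct nodes that eventually deliver \<open>m\<close>. A correct node delivers
  \<open>m\<close> if it is a neighbor of the source, or if it has a neighbor in \<open>L\<close> and a trigger message
  started by another node of \<open>L\<close> reaches it through one further correct neighbor. Hence, in a
  square of correct nodes, two adjacent nodes in \<open>L\<close> force the whole square into \<open>L\<close>.

  The eight nodes surrounding any node are pairwise at distance at most 4, so at most one of them
  is Byzantine. Walking around a node \<open>v\<close> of \<open>L\<close> from a neighbor of \<open>v\<close> in \<open>L\<close>, on the side that
  avoids the Byzantine node, every correct neighbor of \<open>v\<close> is found to lie in \<open>L\<close>. So \<open>L\<close> contains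
  the connected component of the source among the correct nodes. All eight nodes surrounding a
  Byzantine node are correct, so any path in the torus can be rerouted around it, and this
  component consists of all correct nodes.\<close>

section \<open>Coordinates on the torus\<close>

text \<open>Cyclic shifts of a coordinate: with \<open>down\<close>, they turn the absolute
  differences in \<open>adj\<close> into four explicit neighbors.\<close>

definition up :: "nat \<Rightarrow> nat \<Rightarrow> nat" where
  "up N i = (if i = N then 1 else i + 1)"

definition down :: "nat \<Rightarrow> nat \<Rightarrow> nat" where
  "down N i = (if i = 1 then N else i - 1)"

lemma up_down_range:
  assumes "i \<in> {1..N}"
  shows "up N i \<in> {1..N}" "down N i \<in> {1..N}"
  using assms by (auto simp: up_def down_def)

lemma up_down_distinct:
  assumes "N \<ge> 3" "i \<in> {1..N}"
  shows "up N i \<noteq> i" "down N i \<noteq> i" "up N i \<noteq> down N i"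
  using assms by (auto simp: up_def down_def)

lemma cyclic_neighbor_iff:
  assumes "N \<ge> 3" "i \<in> {1..N}" "j \<in> {1..N}"
  shows "\<bar>int i - int j\<bar> \<in> {1, int N - 1} \<longleftrightarrow> j = up N i \<or> j = down N i"
proof -
  have "\<bar>int i - int j\<bar> = 1 \<longleftrightarrow> j = i + 1 \<or> i = j + 1" by linarith
  moreover have "\<bar>int i - int j\<bar> = int N - 1 \<longleftrightarrow> i = 1 \<and> j = N \<or> i = N \<and> j = 1"
    using assms unfolding atLeastAtMost_iff by linarith
  moreover have "i = j + 1 \<longleftrightarrow> i \<noteq> 1 \<and> j = i - 1"
    using assms by auto
  moreover have "j = i + 1 \<longleftrightarrow> i \<noteq> N \<and> j = i + 1"
    using assms by auto
  ultimately show ?thesis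
    unfolding up_def down_def insert_iff empty_iff by presburger
qed

lemma adj_iff:
  assumes "N \<ge> 3" "(i, j) \<in> nodes N"
  shows "((i, j), v) \<in> adj N \<longleftrightarrow>
    v \<in> {(up N i, j), (down N i, j), (i, up N j), (i, down N j)}"
proof (cases v)
  case (Pair k l)
  have ij: "i \<in> {1..N}" "j \<in> {1..N}" using assms(2) by (auto simp: nodes_def)
  show ?thesis
  proof (cases "k \<in> {1..N} \<and> l \<in> {1..N}")
    case True
    then have "((i, j), v) \<in> adj N \<longleftrightarrow>
        i = k \<and> \<bar>int j - int l\<bar> \<in> {1, int N - 1} \<or> j = l \<and> \<bar>int i - int k\<bar> \<in> {1, int N - 1}"
      using ij by (simp add: Pair adj_def nodes_def)
    also have "\<dots> \<longleftrightarrow> i = k \<and> (l = up N j \<or> l = down N j) \<or> j = l \<and> (k = up N i \<or> k = down N i)"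
      using cyclic_neighbor_iff[OF assms(1) ij(1)] cyclic_neighbor_iff[OF assms(1) ij(2)] True
      by blast
    finally show ?thesis unfolding Pair by blast
  next
    case False
    then have "((i, j), v) \<notin> adj N" by (auto simp: Pair adj_def nodes_def)
    moreover have "v \<notin> {(up N i, j), (down N i, j), (i, up N j), (i, down N j)}"
      using False ij up_down_range[OF ij(1)] up_down_range[OF ij(2)] unfolding Pair by blast
    ultimately show ?thesis by blast
  qed
qed

lemma adj_sym: "(u, v) \<in> adj N \<Longrightarrow> (v, u) \<in> adj N"
  by (auto simp: adj_def abs_minus_commute)

lemma adj_nodes: "(u, v) \<in> adj N \<Longrightarrow> u \<in> nodes N \<and> v \<in> nodes N"
  by (auto simp: adj_def)

lemma adj_irrefl: "N \<ge> 3 \<Longrightarrow> (v, v) \<notin> adj N"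
  by (auto simp: adj_def)

lemma finite_neighbors: "finite {q. (p, q) \<in> adj N}"
  by (rule finite_subset[of _ "nodes N"]) (auto simp: adj_def nodes_def)

section \<open>Connectedness of the torus\<close>

lemma interval_closed_induct:
  fixes i j N :: nat
  assumes "i \<in> {1..N}" "j \<in> {1..N}" "P i"
    and up: "\<And>k. k \<in> {1..<N} \<Longrightarrow> P k \<Longrightarrow> P (Suc k)"
    and down: "\<And>k. k \<in> {1..<N} \<Longrightarrow> P (Suc k) \<Longrightarrow> P k"
  shows "P j"
proof (cases "i \<le> j")
  case True
  \<comment> \<open>The bound on \<open>j\<close> is carried inside the induction formula, since
    \<open>P\<close> is known to propagate only within \<open>{1..N}\<close>.\<close>
  then have "j \<le> N \<longrightarrow> P j"
    using assms(1,3) by (induction j rule: dec_induct) (auto intro: up)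
  then show ?thesis using assms(2) by simp
next
  case False
  then have "j \<le> i" by simp
  then have "1 \<le> j \<longrightarrow> P j"
    using assms(1,3) by (induction j rule: inc_induct) (auto intro: down)
  then show ?thesis using assms(2) by simp
qed

text \<open>Walk from \<open>s\<close> to \<open>p\<close> first along the first coordinate, then
  along the second, without wrapping around.\<close>

lemma torus_connected:
  assumes "s \<in> nodes N" "p \<in> nodes N" "s \<in> X"
    and closed: "\<And>u v. u \<in> X \<Longrightarrow> (u, v) \<in> adj N \<Longrightarrow> v \<in> X"
  shows "p \<in> X"
proof -
  obtain a b c d where sp: "s = (a, b)" "p = (c, d)" by fastforce
  have r: "a \<in> {1..N}" "b \<in> {1..N}" "c \<in> {1..N}" "d \<in> {1..N}"
    using assms(1,2) by (auto simp: sp nodes_def)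
  have adj_Suc: "((k, l), (Suc k, l)) \<in> adj N" "((l, k), (l, Suc k)) \<in> adj N"
    if "k \<in> {1..<N}" "l \<in> {1..N}" for k l
    using that by (auto simp: adj_def nodes_def)
  have "(c, b) \<in> X"
    by (rule interval_closed_induct[OF r(1,3), where P = "\<lambda>k. (k, b) \<in> X"])
      (use assms(3) sp r closed adj_Suc adj_sym in blast)+
  then have "(c, d) \<in> X"
    by (rule interval_closed_induct[OF r(2,4), where P = "\<lambda>k. (c, k) \<in> X"])
      (use r closed adj_Suc adj_sym in blast)+
  then show ?thesis by (simp add: sp)
qed

section \<open>Byzantine nodes far apart\<close>

lemma byz_dist_relpow:
  assumes "byz_dist N B \<ge> enat d" "u \<in> B" "v \<in> B" "(u, v) \<in> adj N ^^ k" "k < d"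
  shows "u = v"
proof (rule ccontr)
  assume "u \<noteq> v"
  then have "byz_dist N B \<le> hop_dist N u v"
    unfolding byz_dist_def using assms(2,3) by (intro Inf_lower) blast
  also have "\<dots> \<le> enat k"
    unfolding hop_dist_def using assms(4) by (intro INF_lower) auto
  finally have "enat d \<le> enat k" using assms(1) by (rule order_trans[rotated])
  then show False using assms(5) by simp
qed

text \<open>The radius is chosen so that two such walks, joined at \<open>v\<close>, have length at
  most 4, just below the assumed distance 5.\<close>

definition within2 :: "nat \<Rightarrow> node \<Rightarrow> node \<Rightarrow> bool" where
  "within2 N v u \<longleftrightarrow> (\<exists>k\<le>2. (u, v) \<in> adj N ^^ k)"

lemma within2I:
  "within2 N v v"
  "(v, u) \<in> adj N \<Longrightarrow> within2 N v u"
  "(v, w) \<in> adj N \<Longrightarrow> (w, u) \<in> adj N \<Longrightarrow> within2 N v u"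
proof -
  show "within2 N v v"
    unfolding within2_def by (rule exI[of _ 0]) simp
  show "within2 N v u" if "(v, u) \<in> adj N"
    unfolding within2_def by (rule exI[of _ 1]) (use that[THEN adj_sym] in auto)
  show "within2 N v u" if "(v, w) \<in> adj N" "(w, u) \<in> adj N"
    unfolding within2_def
    by (rule exI[of _ 2]) (use that[THEN adj_sym] in \<open>auto simp: numeral_2_eq_2\<close>)
qed

lemma relpow_adj_sym: "(u, v) \<in> adj N ^^ k \<Longrightarrow> (v, u) \<in> adj N ^^ k"
proof (induction k arbitrary: v)
  case (Suc k)
  then show ?case by (metis adj_sym relpow_Suc_E relpow_Suc_I2)
qed simp

lemma byz_unique_within2:
  assumes "byz_dist N B \<ge> 5" "u \<in> B" "u' \<in> B" "within2 N v u" "within2 N v u'"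
  shows "u = u'"
proof -
  obtain k l where kl: "k \<le> 2" "l \<le> 2" "(u, v) \<in> adj N ^^ k" "(v, u') \<in> adj N ^^ l"
    using assms(4,5) relpow_adj_sym unfolding within2_def by blast
  then have "(u, u') \<in> adj N ^^ (k + l)" by (auto simp: relpow_add)
  moreover have "enat 5 \<le> byz_dist N B" using assms(1) by (simp add: numeral_eq_enat)
  ultimately show ?thesis using byz_dist_relpow assms(2,3) kl(1,2) by fastforce
qed

section \<open>Spreading through squares of correct nodes\<close>

text \<open>In \<open>square\<close>, the node \<open>p\<close> hears the standard message from
  \<open>q\<close> and the trigger message along the path \<open>x\<close>, \<open>y\<close>, \<open>p\<close>.\<close>

locale square_spread =
  fixes N :: nat and B C L :: "node set"
  assumes N: "N \<ge> 3"
    and C: "C = nodes N - B"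
    and far: "byz_dist N B \<ge> 5"
    and L: "L \<subseteq> C"
    and square: "\<And>q x y p. \<lbrakk>q \<in> L; x \<in> L; y \<in> C; p \<in> C; (q, p) \<in> adj N; (x, y) \<in> adj N;
      (y, p) \<in> adj N; q \<noteq> x; q \<noteq> y\<rbrakk> \<Longrightarrow> p \<in> L"
begin

text \<open>The names are compass directions, so \<open>s\<close> is south here and not the source.
  The nine nodes are distinct because \<open>N \<ge> 3\<close> makes a coordinate and its two cyclic
  shifts distinct.\<close>

lemma surrounding_ring:
  assumes "v \<in> nodes N"
  obtains e ne n nw w sw s se where
    "\<And>u. (v, u) \<in> adj N \<longleftrightarrow> u \<in> {e, n, w, s}"
    "(e, ne) \<in> adj N" "(ne, n) \<in> adj N" "(n, nw) \<in> adj N" "(nw, w) \<in> adj N"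
    "(w, sw) \<in> adj N" "(sw, s) \<in> adj N" "(s, se) \<in> adj N" "(se, e) \<in> adj N"
    "distinct [v, e, ne, n, nw, w, sw, s, se]"
proof -
  obtain i j where v: "v = (i, j)" by fastforce
  have ij: "i \<in> {1..N}" "j \<in> {1..N}" using assms by (auto simp: v nodes_def)
  have mem: "(k, l) \<in> nodes N" if "k \<in> {i, up N i, down N i}" "l \<in> {j, up N j, down N j}" for k l
    using that ij up_down_range[OF ij(1)] up_down_range[OF ij(2)] by (auto simp: nodes_def)
  have step: "((k, l), (k', l')) \<in> adj N"
    if "k \<in> {i, up N i, down N i}" "l \<in> {j, up N j, down N j}"
      "k' = up N k \<and> l' = l \<or> k' = down N k \<and> l' = l \<or>
       k' = k \<and> l' = up N l \<or> k' = k \<and> l' = down N l" for k l k' l'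
    using that adj_iff[OF N mem[OF that(1,2)]] by auto
  show thesis
    by (rule that[of "(up N i, j)" "(i, up N j)" "(down N i, j)" "(i, down N j)"
          "(up N i, up N j)" "(down N i, up N j)" "(down N i, down N j)" "(up N i, down N j)"])
      (use adj_iff[OF N] assms up_down_distinct[OF N ij(1)] up_down_distinct[OF N ij(2)] in
        \<open>auto simp: v intro: step adj_sym[OF step]\<close>)
qed

lemma ring_near:
  assumes "\<And>u. (v, u) \<in> adj N \<longleftrightarrow> u \<in> {e, n, w, s}"
    and "(e, ne) \<in> adj N" "(n, nw) \<in> adj N" "(w, sw) \<in> adj N" "(s, se) \<in> adj N"
    and "a \<in> {e, ne, n, nw, w, sw, s, se}"
  shows "within2 N v a" "a \<in> nodes N"
proof -
  have vr: "(v, e) \<in> adj N" "(v, n) \<in> adj N" "(v, w) \<in> adj N" "(v, s) \<in> adj N"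
    using assms(1) by simp_all
  have "within2 N v a \<and> a \<in> nodes N"
    using assms(6) vr[THEN within2I(2)] vr[THEN adj_nodes] assms(2-5)[THEN adj_nodes]
      within2I(3)[OF vr(1) assms(2)] within2I(3)[OF vr(2) assms(3)]
      within2I(3)[OF vr(3) assms(4)] within2I(3)[OF vr(4) assms(5)]
    by (elim insertE emptyE) simp_all
  then show "within2 N v a" "a \<in> nodes N" by simp_all
qed

text \<open>In the square \<open>v\<close>, \<open>a\<close>, \<open>c\<close>, \<open>a'\<close>,
  the node \<open>v\<close> supplies the standard message, while the trigger message of
  \<open>a\<close> reaches \<open>a'\<close> through the corner \<open>c\<close>.\<close>

lemma spread_past_corner:
  assumes "v \<in> L" "(v, a) \<in> adj N" "(v, a') \<in> adj N" "a \<in> L"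
    and "(a, c) \<in> adj N" "(c, a') \<in> adj N" "c \<in> C" "a' \<in> C" "c \<noteq> v"
  shows "a' \<in> L"
  using assms square[of v a c a'] adj_irrefl[OF N] by metis

text \<open>Membership in \<open>L\<close> passes between consecutive neighbors of \<open>v\<close>
  whenever the corner between them is correct. Removing one node from the ring leaves a path, so the
  correct neighbors of \<open>v\<close> stay linked.\<close>

lemma neighbors_in_L:
  assumes v: "v \<in> L" and u: "u \<in> L" "(v, u) \<in> adj N" and z: "z \<in> C" "(v, z) \<in> adj N"
  shows "z \<in> L"
proof -
  have vn: "v \<in> nodes N" using v L C by blast
  obtain e ne n nw w sw s se where
    nb: "\<And>u. (v, u) \<in> adj N \<longleftrightarrow> u \<in> {e, n, w, s}" and
    r: "(e, ne) \<in> adj N" "(ne, n) \<in> adj N" "(n, nw) \<in> adj N" "(nw, w) \<in> adj N"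
       "(w, sw) \<in> adj N" "(sw, s) \<in> adj N" "(s, se) \<in> adj N" "(se, e) \<in> adj N" and
    d: "distinct [v, e, ne, n, nw, w, sw, s, se]"
    by (rule surrounding_ring[OF vn]) blast
  let ?R = "{e, ne, n, nw, w, sw, s, se}"
  note near = ring_near[OF nb r(1,3,5,7)]
  have "a = a'" if "a \<in> ?R" "a' \<in> ?R" "a \<notin> C" "a' \<notin> C" for a a'
    using byz_unique_within2[OF far _ _ near(1)[OF that(1)] near(1)[OF that(2)]]
      near(2)[OF that(1)] near(2)[OF that(2)] that(3,4) unfolding C by blast
  \<comment> \<open>\<open>b\<close> stands for the one ring node that may be Byzantine; if the
    whole ring is correct, any node serves.\<close>
  then have "\<exists>b. \<forall>a \<in> ?R. b = a \<or> a \<in> C"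
    by (metis (no_types, lifting))
  then obtain b where b: "\<forall>a \<in> ?R. b = a \<or> a \<in> C" by blast
  have bs: "b = e \<or> e \<in> C" "b = ne \<or> ne \<in> C" "b = n \<or> n \<in> C" "b = nw \<or> nw \<in> C"
    "b = w \<or> w \<in> C" "b = sw \<or> sw \<in> C" "b = s \<or> s \<in> C" "b = se \<or> se \<in> C"
    using b by simp_all
  have vc: "v \<notin> {ne, nw, sw, se}" using d by simp
  have q: "a' \<in> L" if "a \<in> L" "(a, c) \<in> adj N" "(c, a') \<in> adj N" "a \<in> {e, n, w, s}"
    "a' \<in> {e, n, w, s}" "c \<in> {ne, nw, sw, se}" "c \<in> C" "a' \<in> C" for a c a'
    using spread_past_corner[OF v, of a a' c] nb that vc by blast
  have arc: "a \<in> L \<longleftrightarrow> a' \<in> L" if "(a, c) \<in> adj N" "(c, a') \<in> adj N" "a \<in> {e, n, w, s}"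
    "a' \<in> {e, n, w, s}" "c \<in> {ne, nw, sw, se}" "c \<in> C" "a \<in> C" "a' \<in> C" for a c a'
    using q[of a c a'] q[of a' c a] that adj_sym[OF that(1)] adj_sym[OF that(2)] by argo
  have arcs: "ne \<in> C \<Longrightarrow> e \<in> C \<Longrightarrow> n \<in> C \<Longrightarrow> e \<in> L \<longleftrightarrow> n \<in> L"
    "nw \<in> C \<Longrightarrow> n \<in> C \<Longrightarrow> w \<in> C \<Longrightarrow> n \<in> L \<longleftrightarrow> w \<in> L"
    "sw \<in> C \<Longrightarrow> w \<in> C \<Longrightarrow> s \<in> C \<Longrightarrow> w \<in> L \<longleftrightarrow> s \<in> L"
    "se \<in> C \<Longrightarrow> s \<in> C \<Longrightarrow> e \<in> C \<Longrightarrow> s \<in> L \<longleftrightarrow> e \<in> L"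
    using arc[OF r(1,2)] arc[OF r(3,4)] arc[OF r(5,6)] arc[OF r(7,8)] by simp_all
  have uz: "u = e \<or> u = n \<or> u = w \<or> u = s" "z = e \<or> z = n \<or> z = w \<or> z = s" "u \<in> C"
    using u z nb[of u] nb[of z] L by auto
  show ?thesis
  proof (cases "b \<in> {e, n, w, s}")
    case True
    then have corners: "ne \<in> C" "nw \<in> C" "sw \<in> C" "se \<in> C" using bs d by auto
    \<comment> \<open>Omitting one axis node leaves three that are consecutive on the ring, hence
      joined by two arcs with correct corners.\<close>
    have "e \<in> C \<and> n \<in> C \<and> w \<in> C \<or> n \<in> C \<and> w \<in> C \<and> s \<in> C \<or>
      w \<in> C \<and> s \<in> C \<and> e \<in> C \<or> s \<in> C \<and> e \<in> C \<and> n \<in> C"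
      using bs d by auto
    then show ?thesis
      using arcs(1)[OF corners(1)] arcs(2)[OF corners(2)] arcs(3)[OF corners(3)]
        arcs(4)[OF corners(4)] uz u(1) z(1) by (smt (verit))
  next
    case False
    then have axes: "e \<in> C" "n \<in> C" "w \<in> C" "s \<in> C" using bs by auto
    \<comment> \<open>At most one of the four arcs is broken, and three arcs already link all four
      axis nodes.\<close>
    have "nw \<in> C \<and> sw \<in> C \<and> se \<in> C \<or> ne \<in> C \<and> sw \<in> C \<and> se \<in> C \<or>
      ne \<in> C \<and> nw \<in> C \<and> se \<in> C \<or> ne \<in> C \<and> nw \<in> C \<and> sw \<in> C"
      using bs d by auto
    then show ?thesis
      using arcs(1)[OF _ axes(1,2)] arcs(2)[OF _ axes(2,3)] arcs(3)[OF _ axes(3,4)]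
        arcs(4)[OF _ axes(4,1)] uz u(1) z(1) by (smt (verit))
  qed
qed

section \<open>Rerouting around Byzantine nodes\<close>

lemma correct_neighbor_exists:
  assumes "v \<in> nodes N"
  obtains u where "(v, u) \<in> adj N" "u \<in> C"
proof -
  obtain e ne n nw w sw s se where
    nb: "\<And>u. (v, u) \<in> adj N \<longleftrightarrow> u \<in> {e, n, w, s}" and
    d: "distinct [v, e, ne, n, nw, w, sw, s, se]"
    by (rule surrounding_ring[OF assms]) blast
  have "(v, e) \<in> adj N" "(v, n) \<in> adj N" "e \<noteq> n" using nb d by auto
  then show thesis
    using byz_unique_within2[OF far _ _ within2I(2) within2I(2)] that C adj_nodes by blast
qed

text \<open>Since \<open>v\<close> itself is Byzantine, its whole ring is correct, and
  \<open>K\<close> spreads along the ring from one neighbor of \<open>v\<close> to the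
  others.\<close>

lemma spreads_around_byzantine:
  assumes K: "\<And>u v. u \<in> K \<Longrightarrow> (u, v) \<in> adj N \<Longrightarrow> v \<in> C \<Longrightarrow> v \<in> K"
    and v: "v \<in> B" and u: "u \<in> K" "(v, u) \<in> adj N" and z: "(v, z) \<in> adj N"
  shows "z \<in> K"
proof -
  have vn: "v \<in> nodes N" using z adj_nodes by blast
  obtain e ne n nw w sw s se where
    nb: "\<And>u. (v, u) \<in> adj N \<longleftrightarrow> u \<in> {e, n, w, s}" and
    r: "(e, ne) \<in> adj N" "(ne, n) \<in> adj N" "(n, nw) \<in> adj N" "(nw, w) \<in> adj N"
       "(w, sw) \<in> adj N" "(sw, s) \<in> adj N" "(s, se) \<in> adj N" "(se, e) \<in> adj N" and
    d: "distinct [v, e, ne, n, nw, w, sw, s, se]"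
    by (rule surrounding_ring[OF vn]) blast
  let ?R = "{e, ne, n, nw, w, sw, s, se}"
  have vR: "v \<notin> ?R" using d by simp
  note near = ring_near[OF nb r(1,3,5,7)]
  have ringC: "a \<in> C" if a: "a \<in> ?R" for a
  proof (rule ccontr)
    assume "a \<notin> C"
    then have "a \<in> B" using near(2)[OF a] unfolding C by simp
    then have "a = v" using byz_unique_within2[OF far _ v near(1)[OF a] within2I(1)] by simp
    then show False using a vR by metis
  qed
  have link: "a \<in> K \<longleftrightarrow> a' \<in> K" if "(a, a') \<in> adj N" "a \<in> ?R" "a' \<in> ?R" for a a'
    using K[OF _ that(1) ringC[OF that(3)]] K[OF _ adj_sym[OF that(1)] ringC[OF that(2)]] by argo
  have "e \<in> K \<longleftrightarrow> n \<in> K" "n \<in> K \<longleftrightarrow> w \<in> K" "w \<in> K \<longleftrightarrow> s \<in> K"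
    using link[OF r(1)] link[OF r(2)] link[OF r(3)] link[OF r(4)] link[OF r(5)] link[OF r(6)]
    by simp_all
  then show ?thesis
    using u(1) u(2)[unfolded nb] z[unfolded nb] by (elim insertE emptyE) simp_all
qed

lemma all_correct_in_L:
  assumes s: "s \<in> L" and nbs: "\<And>p. (s, p) \<in> adj N \<Longrightarrow> p \<in> C \<Longrightarrow> p \<in> L" and p: "p \<in> C"
  shows "p \<in> L"
proof -
  \<comment> \<open>A node of \<open>L\<close> passes membership on only if it has a partner in
    \<open>L\<close>, which \<open>neighbors_in_L\<close> requires; a new member of \<open>K\<close>
    has as partner the node it was reached from.\<close>
  define K where "K = {v \<in> L. \<exists>u \<in> L. (v, u) \<in> adj N}"
  \<comment> \<open>Adding the Byzantine nodes enclosed by \<open>K\<close> gives a set closed under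
    all adjacencies, as \<open>torus_connected\<close> demands.\<close>
  define X where "X = K \<union> {v \<in> B. \<forall>u. (v, u) \<in> adj N \<longrightarrow> u \<in> K}"
  have sn: "s \<in> nodes N" using s L C by blast
  have Kclosed: "v \<in> K" if "u \<in> K" "(u, v) \<in> adj N" "v \<in> C" for u v
    using that neighbors_in_L adj_sym unfolding K_def by blast
  have "s \<in> K"
    using s nbs correct_neighbor_exists[OF sn] unfolding K_def by blast
  then have "s \<in> X" by (simp add: X_def)
  moreover have "v \<in> X" if "u \<in> X" "(u, v) \<in> adj N" for u v
  proof (cases "u \<in> K \<and> v \<notin> C")
    case True
    then have "v \<in> B" using that(2) adj_nodes C by blast
    have "z \<in> K" if z: "(v, z) \<in> adj N" for z
      by (rule spreads_around_byzantine[OF _ \<open>v \<in> B\<close> _ adj_sym[OF \<open>(u, v) \<in> adj N\<close>] z])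
        (use True Kclosed in blast)+
    then show ?thesis using \<open>v \<in> B\<close> unfolding X_def by blast
  next
    case False
    then show ?thesis using that Kclosed unfolding X_def by blast
  qed
  ultimately have "p \<in> X"
    using torus_connected[OF sn] p C by blast
  then show ?thesis using p C unfolding X_def K_def by blast
qed

end

section \<open>Progress of the protocol\<close>

lemma multicast_simps [simp]:
  "wait (multicast N p x c) = wait c"
  "trig (multicast N p x c) = trig c"
  "delivered (multicast N p x c) = delivered c"
  "(a, b, y) \<in># net (multicast N p x c) \<longleftrightarrow>
     (a, b, y) \<in># net c \<or> a = p \<and> y = x \<and> (p, b) \<in> adj N"
  using finite_neighbors[of p N] by (auto simp: multicast_def)

lemma deliver_simps [simp]:
  "wait (deliver N p m c) = wait c"
  "trig (deliver N p m c) = trig c"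
  "delivered (deliver N p m c) = (delivered c)(p := insert m (delivered c p))"
  "(a, b, y) \<in># net (deliver N p m c) \<longleftrightarrow>
     (a, b, y) \<in># net c \<or> a = p \<and> y \<in> {Std m, Trigger m {}} \<and> (p, b) \<in> adj N"
  by (auto simp: deliver_def)

lemma handle_mono:
  "wait c p' \<subseteq> wait (handle N H s q p x c) p'"
  "trig c p' \<subseteq> trig (handle N H s q p x c) p'"
  by (cases x; auto)+

text \<open>This monotonicity makes the guard of DECISION persist once its two witnesses have
  arrived.\<close>

lemma step_mono:
  assumes "step N H B s c e c'"
  shows "wait c p \<subseteq> wait c' p" "trig c p \<subseteq> trig c' p"
proof -
  have "wait c p \<subseteq> wait c' p \<and> trig c p \<subseteq> trig c' p"
    using assms
  proof cases
    case (receive_correct q p' x)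
    then show ?thesis
      using handle_mono[of "c\<lparr>net := net c - {#(q, p', x)#}\<rparr>" p] by simp
  qed simp_all
  then show "wait c p \<subseteq> wait c' p" "trig c p \<subseteq> trig c' p" by blast+
qed

lemma handle_delivered_sends:
  assumes "m \<in> delivered (handle N H s q' p' y c) p" "m \<notin> delivered c p"
    and "(p, q) \<in> adj N" "x \<in> {Std m, Trigger m {}}"
  shows "(p, q, x) \<in># net (handle N H s q' p' y c)"
proof (cases y)
  case (Std m')
  then show ?thesis using assms by (cases "q' = s"; cases "p = p'") auto
next
  case (Trigger m' S)
  then have "delivered (handle N H s q' p' y c) p = delivered c p" by simp
  then show ?thesis using assms by blast
qed

text \<open>Only \<open>deliver\<close> enlarges \<open>delivered\<close>, and it multicasts both
  messages in the same step.\<close>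

lemma step_delivered_sends:
  assumes "step N H B s c e c'" "m \<in> delivered c' p" "m \<notin> delivered c p"
    and "(p, q) \<in> adj N" "x \<in> {Std m, Trigger m {}}"
  shows "(p, q, x) \<in># net c'"
  using assms(1)
proof cases
  case (receive_correct q' p' y)
  then show ?thesis
    using handle_delivered_sends[OF _ _ assms(4,5)] assms(2,3) by simp
next
  case (decide p' m')
  then show ?thesis using assms by (cases "p = p'") auto
qed (use assms in auto)

section \<open>Consequences of fairness\<close>

locale fair_execution =
  fixes N H :: nat and B :: "node set" and s :: node and m :: 'm
    and cfg :: "nat \<Rightarrow> 'm config" and ev :: "nat \<Rightarrow> 'm event"
  assumes exec: "execution N H B s m cfg ev"
begin

definition eventually_delivers :: "node set" where
  "eventually_delivers = {p \<in> nodes N - B. \<exists>t. m \<in> delivered (cfg t) p}"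

lemma step: "step N H B s (cfg t) (ev t) (cfg (Suc t))"
  using exec by (simp add: execution_def)

lemma wait_trig_mono:
  assumes "t \<le> t'"
  shows "wait (cfg t) p \<subseteq> wait (cfg t') p" "trig (cfg t) p \<subseteq> trig (cfg t') p"
  by (rule lift_Suc_mono_le[OF _ assms, of "\<lambda>t. wait (cfg t) p"], rule step_mono[OF step])
    (rule lift_Suc_mono_le[OF _ assms, of "\<lambda>t. trig (cfg t) p"], rule step_mono[OF step])

lemma sent_is_handled:
  assumes "(q, p, x) \<in># net (cfg t)" "p \<in> nodes N - B"
  obtains t' c where "cfg t' = handle N H s q p x c"
proof -
  obtain t' where "ev t' = Receive q p x"
    using exec assms(1) unfolding execution_def by blast
  then have "step N H B s (cfg t') (Receive q p x) (cfg (Suc t'))"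
    using step[of t'] by simp
  then show thesis
    using assms(2) that by cases auto
qed

text \<open>The messages are in flight right after \<open>p\<close> first delivers \<open>m\<close>;
  the induction goes back to that moment, which for the source is \<open>init\<close>.\<close>

lemma delivered_sends:
  assumes "m \<in> delivered (cfg t) p" "(p, q) \<in> adj N" "x \<in> {Std m, Trigger m {}}"
  shows "\<exists>t. (p, q, x) \<in># net (cfg t)"
  using assms(1)
proof (induction t)
  case 0
  have "cfg 0 = init N s m" using exec by (simp add: execution_def)
  then have "(p, q, x) \<in># net (cfg 0)"
    using 0 assms(2,3) by (auto simp: init_def split: if_splits)
  then show ?case by blast
next
  case (Suc t)
  then show ?case using step_delivered_sends[OF step _ _ assms(2,3)] by blast
qed

lemma source_delivers: "s \<in> nodes N - B \<Longrightarrow> s \<in> eventually_delivers"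
  using exec unfolding eventually_delivers_def execution_def init_def
  by (auto intro!: exI[of _ 0])

lemma source_neighbor_delivers:
  assumes "s \<in> eventually_delivers" "(s, p) \<in> adj N" "p \<in> nodes N - B"
  shows "p \<in> eventually_delivers"
proof -
  obtain t where "m \<in> delivered (cfg t) s"
    using assms(1) unfolding eventually_delivers_def by blast
  then obtain t where "(s, p, Std m) \<in># net (cfg t)"
    using delivered_sends assms(2) by blast
  then obtain t' c where "cfg t' = handle N H s s p (Std m) c"
    using sent_is_handled assms(3) by blast
  then have "m \<in> delivered (cfg t') p" by simp
  then show ?thesis using assms(3) unfolding eventually_delivers_def by blast
qed

lemma neighbor_waits:
  assumes "q \<in> eventually_delivers" "(q, p) \<in> adj N" "p \<in> nodes N - B" "q \<noteq> s"
  obtains t where "(m, q) \<in> wait (cfg t) p"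
proof -
  obtain t where "m \<in> delivered (cfg t) q"
    using assms(1) unfolding eventually_delivers_def by blast
  then obtain t where "(q, p, Std m) \<in># net (cfg t)"
    using delivered_sends assms(2) by blast
  then obtain t' c where "cfg t' = handle N H s q p (Std m) c"
    using sent_is_handled assms(3) by blast
  then have "(m, q) \<in> wait (cfg t') p" using assms(4) by simp
  then show thesis by (rule that)
qed

lemma trigger_two_hops:
  assumes "H \<ge> 2" "x \<in> eventually_delivers" "y \<in> nodes N - B" "p \<in> nodes N - B"
    and "(x, y) \<in> adj N" "(y, p) \<in> adj N" "x \<noteq> y"
  obtains t where "(m, {x, y}) \<in> trig (cfg t) p"
proof -
  obtain t where "m \<in> delivered (cfg t) x"
    using assms(2) unfolding eventually_delivers_def by blast
  then obtain t where "(x, y, Trigger m {}) \<in># net (cfg t)"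
    using delivered_sends assms(5) by blast
  then obtain t c where "cfg t = handle N H s x y (Trigger m {}) c"
    using sent_is_handled assms(3) by blast
  then have "(y, p, Trigger m {x}) \<in># net (cfg t)"
    using assms(1,6) by simp
  then obtain t c where "cfg t = handle N H s y p (Trigger m {x}) c"
    using sent_is_handled assms(4) by blast
  \<comment> \<open>TRANSMISSION at \<open>p\<close> tests \<open>y \<notin> {x}\<close> and
    \<open>1 \<le> H - 1\<close>; the latter is the condition \<open>H \<ge> 2\<close>.\<close>
  then have "(m, {x, y}) \<in> trig (cfg t) p"
    using assms(1,7) by (simp add: insert_commute)
  then show thesis by (rule that)
qed

lemma square_delivers:
  assumes "H \<ge> 2" "q \<in> eventually_delivers" "x \<in> eventually_delivers"
    and "y \<in> nodes N - B" "p \<in> nodes N - B"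
    and "(q, p) \<in> adj N" "(x, y) \<in> adj N" "(y, p) \<in> adj N" "x \<noteq> y" "q \<noteq> x" "q \<noteq> y"
  shows "p \<in> eventually_delivers"
\<comment> \<open>A standard message from the source is delivered at once and leaves no entry in
  \<open>wait\<close>, so this case is separate.\<close>
proof (cases "q = s")
  case True
  then show ?thesis using source_neighbor_delivers assms by blast
next
  case False
  obtain t where t: "(m, q) \<in> wait (cfg t) p"
    using neighbor_waits assms False by blast
  obtain t' where t': "(m, {x, y}) \<in> trig (cfg t') p"
    using trigger_two_hops assms by blast
  \<comment> \<open>The two witnesses may arrive in either order; by monotonicity both are present
    at the later time.\<close>
  have "(m, q) \<in> wait (cfg (max t t')) p" "(m, {x, y}) \<in> trig (cfg (max t t')) p"
    using wait_trig_mono[of t "max t t'" p] wait_trig_mono[of t' "max t t'" p] t t' by auto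
  then have "decidable (cfg (max t t')) p m"
    using assms(10,11) unfolding decidable_def by blast
  \<comment> \<open>Fairness does not place \<open>u\<close> after \<open>max t t'\<close>, but a
    DECISION on \<open>m\<close> at any time delivers it.\<close>
  then obtain u where "ev u = Decide p m"
    using exec assms(5) unfolding execution_def by blast
  then have "step N H B s (cfg u) (Decide p m) (cfg (Suc u))"
    using step[of u] by simp
  then have "m \<in> delivered (cfg (Suc u)) p"
    by cases simp
  then show ?thesis using assms(5) unfolding eventually_delivers_def by blast
qed

end

theorem theorem4:
  fixes N :: nat and B :: "node set" and s :: node and m :: 'm
    and cfg :: "nat \<Rightarrow> 'm config" and ev :: "nat \<Rightarrow> 'm event"
  assumes "N \<ge> 3"
    and "B \<subseteq> nodes N"
    and "s \<in> nodes N - B"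
    and "byz_dist N B \<ge> 5"
    and "execution N 2 B s m cfg ev"
  shows "\<forall>p \<in> nodes N - B. \<exists>t. m \<in> delivered (cfg t) p"
proof -
  interpret fair_execution N 2 B s m cfg ev
    by standard (rule assms)
  interpret square_spread N B "nodes N - B" eventually_delivers
  proof
    show "eventually_delivers \<subseteq> nodes N - B"
      unfolding eventually_delivers_def by blast
    show "p \<in> eventually_delivers"
      if "q \<in> eventually_delivers" "x \<in> eventually_delivers" "y \<in> nodes N - B"
        "p \<in> nodes N - B" "(q, p) \<in> adj N" "(x, y) \<in> adj N" "(y, p) \<in> adj N" "q \<noteq> x" "q \<noteq> y"
      for q x y p
      using square_delivers[OF _ that(1-7) _ that(8,9)] that(6) adj_irrefl[OF assms(1)] by fastforce
  qed (use assms in auto)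
  have "s \<in> eventually_delivers"
    using source_delivers assms(3) .
  then have "p \<in> eventually_delivers" if "p \<in> nodes N - B" for p
    using all_correct_in_L[OF _ _ that] source_neighbor_delivers by blast
  then show ?thesis unfolding eventually_delivers_def by blast
qed

end
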